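(* For every integer $n\ge 6$ with $n\equiv 6\pmod 8$, there is no whirling knight's tour on the $n\times n$ board whose coil count is $c=n/2$.
   Context: Let $n$ be a positive even integer. The cells of the $n\times n$ board are the integer pairs $(i,j)$ with $0\le i,j\le n-1$, where $i$ is the row index (counted from the top) and $j$ the column index (counted from the left); each cell is identified with the point $(i,j)$ of the plane. The pivot is the point $(p,q)=\bigl(\tfrac{n-1}{2},\tfrac{n-1}{2}\bigr)$, the centre of the board. The whirling-knight digraph on the board has vertex set $V=\{0,\dots,n-1\}^2$ and has an arc $(i,j)\to(i',j')$ exactly when $(i-i')^2+(j-j')^2=5$ (a knight step) and the step is counter-clockwise (CCW) about the pivot, meaning $$(i-p)(j'-q) > (i'-p)(j-q).$$ A whirling knight's tour on the $n\times n$ board is a Hamiltonian directed cycle in this digraph. The north plumb-line is the open ray $\{(x,q): x<p\}$ (first coordinate is the row coordinate). An arc crosses the north plumb-line if the straight segment joining its two endpoint cells meets this ray. The coil count $c$ of a whirling tour is the number of its arcs that cross the north plumb-line (equivalently, the winding number of the cycle about the pivot). *)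

theory Defs
  imports "HOL-Analysis.Analysis" "Graph_Theory.Pair_Digraph"
begin

(* Arc_Walk.cycle makes the vertices visited by a cycle distinct, so covering verts G
   means visiting each vertex exactly once. *)
definition (in pre_digraph) hamiltonian_cycle :: "'b awalk \<Rightarrow> bool" where
  "hamiltonian_cycle p \<longleftrightarrow> cycle p \<and> tail G ` set p = verts G"

type_synonym cell = "int \<times> int"

definition board :: "nat \<Rightarrow> cell set" where
  "board n = {0..int n - 1} \<times> {0..int n - 1}"

definition cell_point :: "cell \<Rightarrow> real \<times> real" where
  "cell_point c = (real_of_int (fst c), real_of_int (snd c))"

definition pivot :: "nat \<Rightarrow> real \<times> real" where
  "pivot n = ((real n - 1) / 2, (real n - 1) / 2)"

definition knight_step :: "cell \<Rightarrow> cell \<Rightarrow> bool" where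
  "knight_step c c' \<longleftrightarrow> (fst c - fst c')\<^sup>2 + (snd c - snd c')\<^sup>2 = 5"

(* The first coordinate is the row, which grows downwards; with this orientation the
   inequality below is the counter-clockwise one. *)
definition ccw :: "real \<times> real \<Rightarrow> real \<times> real \<Rightarrow> real \<times> real \<Rightarrow> bool" where
  "ccw z x x' \<longleftrightarrow>
     (fst x - fst z) * (snd x' - snd z) > (fst x' - fst z) * (snd x - snd z)"

definition whirling_knight_digraph :: "nat \<Rightarrow> cell pair_pre_digraph" where
  "whirling_knight_digraph n =
     \<lparr> pverts = board n,
       parcs = {(c, c'). c \<in> board n \<and> c' \<in> board n \<and> knight_step c c' \<and>
                         ccw (pivot n) (cell_point c) (cell_point c')} \<rparr>"

definition whirling_tour :: "nat \<Rightarrow> (cell \<times> cell) list \<Rightarrow> bool" where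
  "whirling_tour n t \<longleftrightarrow>
     pre_digraph.hamiltonian_cycle (with_proj (whirling_knight_digraph n)) t"

definition north_plumb_line :: "nat \<Rightarrow> (real \<times> real) set" where
  "north_plumb_line n = {(x, y). x < fst (pivot n) \<and> y = snd (pivot n)}"

definition crosses_north :: "nat \<Rightarrow> cell \<times> cell \<Rightarrow> bool" where
  "crosses_north n e \<longleftrightarrow>
     closed_segment (cell_point (fst e)) (cell_point (snd e)) \<inter> north_plumb_line n \<noteq> {}"

definition coil_count :: "nat \<Rightarrow> (cell \<times> cell) list \<Rightarrow> nat" where
  "coil_count n t = card {e \<in> set t. crosses_north n e}"

end

theory Submission
  imports Defs
begin

text \<open>
  Write \<open>n = 2 * m\<close>, and call north-west diagonal the cells \<open>(d, d)\<close> with \<open>d < m\<close>.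

  The polar angle about the pivot strictly increases along every arc, so each revolution of a
  tour meets the north-west diagonal at most once. The diagonal has \<open>m\<close> cells, all of which are
  visited, so a tour makes at least \<open>m\<close> revolutions; if it makes exactly \<open>m\<close>, then it has
  no arc to spare for jumping over the diagonal without landing on it
  (\<open>minimal_tour_no_diagonal_jump\<close>). The crossings of the diagonal are compared with those of the
  north plumb-line by a telescoping sum: the two numbers of crossings differ on each arc by the
  change of the indicator of the sector between the two rays.

  The ban on jumps is then refuted by Hall's condition. A knight step changes \<open>j - i\<close> by an odd
  number. Take the set \<open>L\<close> (\<open>hall_tails\<close>) of the cells with \<open>j - i\<close> positive and even in the part
  of the north triangle left of the plumb-line, together with every fourth cell of the first
  column to the right of that line. Every arc that leaves \<open>L\<close> without jumping over the diagonal
  ends in a set \<open>R\<close> (\<open>hall_heads\<close>) of cells with \<open>j - i\<close> positive and odd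
  (\<open>hall_tails_arc\<close>). The right-hand border of \<open>L\<close> and \<open>R\<close> is ragged with period four. As
  \<open>m\<close> is 3 modulo 4, it meets the diagonal in such a way that \<open>R\<close> has fewer cells than \<open>L\<close>
  (\<open>card_hall_heads_less\<close>), while the successors of the cells of \<open>L\<close> along a tour are distinct.
\<close>

section \<open>Hamiltonian cycles as permutations of the vertices\<close>

text \<open>
  For a closed walk, the list of tails is a rotation of the list of heads; the latter is what
  the definition of a cycle makes distinct.
\<close>

lemma (in pre_digraph) hamiltonian_cycle_bij:
  assumes "hamiltonian_cycle p"
  shows "set p \<subseteq> arcs G"
    and "bij_betw (tail G) (set p) (verts G)"
    and "bij_betw (head G) (set p) (verts G)"
proof -
  obtain u where walk: "awalk u p u" and dist: "distinct (tl (awalk_verts u p))"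
    and ne: "p \<noteq> []" and cover: "tail G ` set p = verts G"
    using assms unfolding hamiltonian_cycle_def cycle_def by auto
  have cas: "cas u p u" and sub: "set p \<subseteq> arcs G"
    using walk unfolding awalk_def by auto
  have "tail G (hd p) = u"
    using cas ne by (simp add: cas_simp)
  then have verts: "awalk_verts u p = u # map (head G) p"
    using awalk_verts_conv'[OF cas] ne by simp
  have verts': "awalk_verts u p = map (tail G) p @ [head G (last p)]"
    using awalk_verts_conv[of u p] ne by simp
  have "head G (last q) = w" if "cas v q w" "q \<noteq> []" for v q w
    using that by (induction q arbitrary: v) (auto split: if_splits)
  then have "head G (last p) = u"
    using cas ne by blast
  then have "mset (u # map (head G) p) = mset (map (tail G) p @ [u])"
    using verts verts' by simp
  then have rot: "mset (map (head G) p) = mset (map (tail G) p)"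
    by simp
  have dist_heads: "distinct (map (head G) p)"
    using dist verts by simp
  then have dist_tails: "distinct (map (tail G) p)"
    using mset_eq_imp_distinct_iff[OF rot] by simp
  have "head G ` set p = tail G ` set p"
    using mset_eq_setD[OF rot] by simp
  then show "set p \<subseteq> arcs G" "bij_betw (tail G) (set p) (verts G)"
    "bij_betw (head G) (set p) (verts G)"
    using sub cover dist_heads dist_tails by (auto simp: bij_betw_def distinct_map)
qed

section \<open>Whirling arcs in integer coordinates\<close>

text \<open>
  Offsets from the pivot, doubled so as to be integers. As \<open>n\<close> is even they are odd, hence never
  zero.
\<close>

definition row_off :: "nat \<Rightarrow> cell \<Rightarrow> int" where
  "row_off n c = 2 * fst c - (int n - 1)"

definition col_off :: "nat \<Rightarrow> cell \<Rightarrow> int" where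
  "col_off n c = 2 * snd c - (int n - 1)"

lemma odd_col_off: "even n \<Longrightarrow> odd (col_off n c)"
  by (simp add: col_off_def)

lemma ccw_iff:
  "ccw (pivot n) (cell_point c) (cell_point c') \<longleftrightarrow>
     row_off n c * col_off n c' > row_off n c' * col_off n c"
proof -
  have half: "real_of_int (fst d) - (real n - 1) / 2 = real_of_int (row_off n d) / 2"
    "real_of_int (snd d) - (real n - 1) / 2 = real_of_int (col_off n d) / 2" for d
    by (simp_all add: row_off_def col_off_def field_simps)
  have "ccw (pivot n) (cell_point c) (cell_point c') \<longleftrightarrow>
      real_of_int (row_off n c) * real_of_int (col_off n c') >
      real_of_int (row_off n c') * real_of_int (col_off n c)"
    by (simp add: ccw_def pivot_def cell_point_def half)
  also have "\<dots> \<longleftrightarrow> row_off n c * col_off n c' > row_off n c' * col_off n c"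
    by (metis of_int_less_iff of_int_mult)
  finally show ?thesis .
qed

abbreviation whirling_arcs :: "nat \<Rightarrow> (cell \<times> cell) set" where
  "whirling_arcs n \<equiv> parcs (whirling_knight_digraph n)"

lemma whirling_arc_iff:
  "(c, c') \<in> whirling_arcs n \<longleftrightarrow> c \<in> board n \<and> c' \<in> board n \<and> knight_step c c' \<and>
     row_off n c * col_off n c' > row_off n c' * col_off n c"
  by (simp add: whirling_knight_digraph_def ccw_iff)

lemma knight_step_cases:
  assumes "knight_step (i, j) (i', j')"
  shows "(i' - i, j' - j) \<in>
    {(1, 2), (1, -2), (-1, 2), (-1, -2), (2, 1), (2, -1), (-2, 1), (-2, -1)}"
proof -
  have eq: "(i' - i)\<^sup>2 + (j' - j)\<^sup>2 = 5"
    using assms by (simp add: knight_step_def power2_commute)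
  have bound: "\<bar>x\<bar> \<le> 2" if "x\<^sup>2 + y\<^sup>2 = 5" for x y :: int
  proof -
    have "x\<^sup>2 < 9"
      using that zero_le_power2[of y] by linarith
    then have "\<bar>x\<bar>\<^sup>2 < 3\<^sup>2"
      by simp
    then show ?thesis
      using power_less_imp_less_base[of "\<bar>x\<bar>" 2 3] by simp
  qed
  have "\<bar>i' - i\<bar> \<le> 2" "\<bar>j' - j\<bar> \<le> 2"
    using bound[OF eq] bound[of "j' - j" "i' - i"] eq by (simp_all add: add.commute)
  then have "i' - i \<in> {-2, -1, 0, 1, 2}" "j' - j \<in> {-2, -1, 0, 1, 2}"
    by auto
  then show ?thesis
    using eq by auto
qed

lemma tour_bij:
  assumes "whirling_tour n t"
  shows "set t \<subseteq> whirling_arcs n"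
    and "bij_betw fst (set t) (board n)"
    and "bij_betw snd (set t) (board n)"
proof -
  have "pverts (whirling_knight_digraph n) = board n"
    by (simp add: whirling_knight_digraph_def)
  then show "set t \<subseteq> whirling_arcs n" "bij_betw fst (set t) (board n)"
    "bij_betw snd (set t) (board n)"
    using pre_digraph.hamiltonian_cycle_bij[OF assms[unfolded whirling_tour_def]] by simp_all
qed

section \<open>A tour with few coils cannot jump over the diagonal\<close>

lemma crosses_northI:
  assumes arc: "(c, c') \<in> whirling_arcs n" and "col_off n c > 0" "col_off n c' < 0"
  shows "crosses_north n (c, c')"
proof -
  define u v u' v' where "u = real_of_int (row_off n c)" "v = real_of_int (col_off n c)"
    "u' = real_of_int (row_off n c')" "v' = real_of_int (col_off n c')"
  note uv = this
  have signs: "v > 0" "v' < 0"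
    using assms(2,3) by (simp_all add: uv)
  have ccw: "u' * v < u * v'"
    using arc unfolding whirling_arc_iff uv by (metis of_int_less_iff of_int_mult)
  \<comment> \<open>the parameter at which the segment reaches the column of the pivot\<close>
  define s where "s = v / (v - v')"
  have s: "0 \<le> s" "s \<le> 1" and s_mult: "s * (v - v') = v"
    using signs by (simp_all add: s_def)
  have "(1 - s) * v + s * v' = v - s * (v - v')"
    by (simp add: algebra_simps)
  then have zero: "(1 - s) * v + s * v' = 0"
    using s_mult by simp
  have "((1 - s) * u + s * u') * (v - v') = u * (v - v') + (u' - u) * (s * (v - v'))"
    by (simp add: algebra_simps)
  also have "\<dots> = u' * v - u * v'"
    unfolding s_mult by (simp add: algebra_simps)
  finally have "((1 - s) * u + s * u') * (v - v') < 0"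
    using ccw by simp
  then have neg: "(1 - s) * u + s * u' < 0"
    using signs by (simp add: mult_less_0_iff)
  define h where "h = (real n - 1) / 2"
  have coords: "cell_point c = (u / 2 + h, v / 2 + h)" "cell_point c' = (u' / 2 + h, v' / 2 + h)"
    by (simp_all add: cell_point_def uv row_off_def col_off_def h_def diff_divide_distrib)
  have mix: "(1 - s) * (x / 2 + h) + s * (y / 2 + h) = ((1 - s) * x + s * y) / 2 + h" for x y
    by (simp add: ring_distribs add_divide_distrib diff_divide_distrib)
  define P where "P = (1 - s) *\<^sub>R cell_point c + s *\<^sub>R cell_point c'"
  have "P \<in> closed_segment (cell_point c) (cell_point c')"
    using s by (auto simp: P_def closed_segment_def)
  moreover have "fst P = ((1 - s) * u + s * u') / 2 + h" "snd P = ((1 - s) * v + s * v') / 2 + h"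
    by (simp_all add: P_def coords mix)
  then have "fst P < h" "snd P = h"
    using neg zero by simp_all
  then have "P \<in> north_plumb_line n"
    by (simp add: north_plumb_line_def pivot_def case_prod_unfold h_def)
  ultimately show ?thesis
    by (auto simp: crosses_north_def)
qed

text \<open>The cells between the north plumb-line and the north-west diagonal.\<close>

definition sector :: "nat \<Rightarrow> cell \<Rightarrow> bool" where
  "sector n c \<longleftrightarrow> row_off n c < col_off n c \<and> col_off n c < 0"

text \<open>
  An arc enters the sector only through the plumb-line, and leaves it only through the diagonal.
  Hence this quantity, which counts the plumb-line crossings minus the entries into the sector
  plus the exits from it, is the number of times that the arc crosses or reaches the diagonal.
\<close>

definition diagonal_crossings :: "nat \<Rightarrow> cell \<times> cell \<Rightarrow> int" where
  "diagonal_crossings n e =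
     of_bool (crosses_north n e) + of_bool (sector n (fst e)) - of_bool (sector n (snd e))"

lemma sum_diagonal_crossings:
  assumes "whirling_tour n t"
  shows "(\<Sum>e\<in>set t. diagonal_crossings n e) = int (coil_count n t)"
proof -
  have "(\<Sum>e\<in>set t. of_bool (sector n (fst e)) :: int) = (\<Sum>c\<in>board n. of_bool (sector n c))"
    using tour_bij(2)[OF assms] by (rule sum.reindex_bij_betw)
  moreover have "(\<Sum>e\<in>set t. of_bool (sector n (snd e)) :: int) = (\<Sum>c\<in>board n. of_bool (sector n c))"
    using tour_bij(3)[OF assms] by (rule sum.reindex_bij_betw)
  moreover have "(\<Sum>e\<in>set t. of_bool (crosses_north n e)) = int (coil_count n t)"
    by (simp add: coil_count_def sum.If_cases of_bool_def Int_def)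
  ultimately show ?thesis
    by (simp add: diagonal_crossings_def sum.distrib sum_subtractf)
qed

lemma diagonal_crossings_nonneg:
  assumes "even n" and arc: "(c, c') \<in> whirling_arcs n"
  shows "diagonal_crossings n (c, c') \<ge> 0"
proof (cases "sector n c' \<and> \<not> sector n c")
  case True
  have "col_off n c > 0"
  proof (rule ccontr)
    assume "\<not> col_off n c > 0"
    then have neg: "col_off n c < 0"
      using odd_col_off[OF \<open>even n\<close>, of c] by (cases "col_off n c = 0") auto
    have "row_off n c \<ge> col_off n c" "row_off n c' < col_off n c'" "col_off n c' < 0"
      using True neg by (auto simp: sector_def)
    \<comment> \<open>the tail lies on or beyond the diagonal, the head before it, so the turn is clockwise\<close>
    then have "row_off n c * col_off n c' \<le> col_off n c * col_off n c'"
      "col_off n c * col_off n c' \<le> row_off n c' * col_off n c"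
      using neg by (simp_all add: mult_right_mono_neg mult.commute[of "col_off n c"])
    then show False
      using arc by (simp add: whirling_arc_iff)
  qed
  then have "crosses_north n (c, c')"
    using crosses_northI[OF arc] True by (simp add: sector_def)
  then show ?thesis
    by (simp add: diagonal_crossings_def)
next
  case False
  then show ?thesis
    by (auto simp: diagonal_crossings_def)
qed

text \<open>
  Both an arc that lands on the diagonal and one that jumps over it from above have a tail in the
  sector or to the right of the plumb-line.
\<close>

lemma diagonal_crossings_pos:
  assumes "even n" and arc: "(c, c') \<in> whirling_arcs n"
    and left: "col_off n c' < 0" and beyond: "col_off n c' \<le> row_off n c'"
    and start: "row_off n c < col_off n c"
  shows "diagonal_crossings n (c, c') \<ge> 1"
proof (cases "col_off n c > 0")
  case True
  then have "crosses_north n (c, c')"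
    using crosses_northI[OF arc] left by simp
  then show ?thesis
    using beyond by (simp add: diagonal_crossings_def sector_def)
next
  case False
  then have "col_off n c < 0"
    using odd_col_off[OF \<open>even n\<close>, of c] by (cases "col_off n c = 0") auto
  then show ?thesis
    using start beyond by (simp add: diagonal_crossings_def sector_def)
qed

definition nw_diagonal :: "nat \<Rightarrow> cell set" where
  "nw_diagonal n = (\<lambda>d. (d, d)) ` {0..<int n div 2}"

lemma card_nw_diagonal: "card (nw_diagonal n) = n div 2"
  by (simp add: nw_diagonal_def card_image inj_on_def)

lemma nw_diagonal_subset_board: "nw_diagonal n \<subseteq> board n"
  by (auto simp: nw_diagonal_def board_def)

lemma nw_diagonal_off:
  assumes "even n" "c \<in> nw_diagonal n"
  shows "col_off n c < 0" "row_off n c = col_off n c"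
  using assms by (auto simp: nw_diagonal_def row_off_def col_off_def)

lemma minimal_tour_no_diagonal_jump:
  assumes "even n" and tour: "whirling_tour n t" and coils: "coil_count n t = n div 2"
    and e: "(c, c') \<in> set t" and start: "row_off n c < col_off n c"
  shows "col_off n c' > 0 \<or> row_off n c' \<le> col_off n c'"
proof (rule ccontr)
  assume "\<not> ?thesis"
  then have jump: "col_off n c' < 0" "col_off n c' < row_off n c'"
    using odd_col_off[OF \<open>even n\<close>, of c'] by (cases "col_off n c' = 0"; simp)+
  note arcs = tour_bij(1)[OF tour] and heads = tour_bij(3)[OF tour]
  define A where "A = {e \<in> set t. snd e \<in> nw_diagonal n}"
  have "snd ` A = nw_diagonal n"
    using heads nw_diagonal_subset_board[of n] by (force simp: A_def bij_betw_def)
  moreover have "inj_on snd A"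
    using heads by (auto simp: A_def bij_betw_def inj_on_def)
  ultimately have card_A: "card A = n div 2"
    using card_image card_nw_diagonal by metis
  have landing: "diagonal_crossings n a \<ge> 1" if a: "a \<in> A" for a
  proof -
    obtain d d' where [simp]: "a = (d, d')"
      by (cases a)
    have arc: "(d, d') \<in> whirling_arcs n" and diag: "d' \<in> nw_diagonal n"
      using a arcs by (auto simp: A_def)
    note off = nw_diagonal_off[OF \<open>even n\<close> diag]
    have "row_off n d * col_off n d' > col_off n d * col_off n d'"
      using arc off(2) by (simp add: whirling_arc_iff mult.commute)
    then have "row_off n d < col_off n d"
      using off(1) by simp
    then show ?thesis
      using diagonal_crossings_pos[OF \<open>even n\<close> arc off(1)] off(2) by simp
  qed
  have not_A: "(c, c') \<notin> A"
    using jump nw_diagonal_off(2)[OF \<open>even n\<close>, of c'] by (auto simp: A_def)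
  have fin: "finite A"
    by (simp add: A_def)
  have "int (n div 2) + 1 \<le> (\<Sum>a\<in>A. diagonal_crossings n a) + diagonal_crossings n (c, c')"
  proof (rule add_mono)
    show "int (n div 2) \<le> (\<Sum>a\<in>A. diagonal_crossings n a)"
      using sum_bounded_below[of A 1 "diagonal_crossings n"] landing card_A by simp
    show "1 \<le> diagonal_crossings n (c, c')"
      using diagonal_crossings_pos[OF \<open>even n\<close> _ jump(1) _ start] jump(2) e arcs by auto
  qed
  also have "\<dots> = (\<Sum>a\<in>insert (c, c') A. diagonal_crossings n a)"
    using fin not_A by simp
  also have "\<dots> \<le> (\<Sum>a\<in>set t. diagonal_crossings n a)"
    using e arcs diagonal_crossings_nonneg[OF \<open>even n\<close>]
    by (intro sum_mono2) (auto simp: A_def)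
  also have "\<dots> = int (n div 2)"
    using sum_diagonal_crossings[OF tour] coils by simp
  finally show False
    by simp
qed

section \<open>A violation of Hall's condition\<close>

text \<open>
  The parameter \<open>m\<close> is half the side of the board, so the plumb-line separates the columns
  \<open>m - 1\<close> and \<open>m\<close>. The border has period four because the cells of \<open>L\<close> in column \<open>m\<close>
  reach column \<open>m - 1\<close> only by the steps \<open>(2, -1)\<close> and \<open>(-2, -1)\<close>: from the rows that are 1 modulo 4
  they arrive in rows that are 3 modulo 4, so \<open>R\<close> can omit the rows of column \<open>m - 1\<close> that
  are 1 modulo 4.
\<close>

definition hall_tails :: "int \<Rightarrow> cell set" where
  "hall_tails m = {(i, j). 0 \<le> i \<and> i < j \<and> even (j - i) \<and> (j < m \<or> j = m \<and> i mod 4 = 1)}"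

definition hall_heads :: "int \<Rightarrow> cell set" where
  "hall_heads m = {(i, j). 0 \<le> i \<and> i < j \<and> odd (j - i) \<and> j < m \<and> \<not> (j = m - 1 \<and> i mod 4 = 1)}"

lemma finite_hall_tails: "finite (hall_tails m)"
proof (rule finite_subset)
  show "hall_tails m \<subseteq> {0..m} \<times> {0..m}"
    by (auto simp: hall_tails_def)
qed simp

text \<open>
  Shifting a cell one column to the right maps \<open>R\<close> into \<open>L\<close>, except in the last column of \<open>R\<close>.
  There the shift is corrected by two rows, from 3 to 1 modulo 4, and the lowest cell
  \<open>(m - 2, m)\<close> of column \<open>m\<close> in \<open>L\<close> is missed.
\<close>

lemma card_hall_heads_less:
  assumes "0 \<le> m" "m mod 4 = 3"
  shows "card (hall_heads m) < card (hall_tails m)"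
proof -
  define f :: "cell \<Rightarrow> cell" where "f = (\<lambda>(i, j). if j = m - 1 then (i - 2, m) else (i, j + 1))"
  have "inj_on f (hall_heads m)"
    by (auto simp: inj_on_def f_def hall_heads_def split: if_splits)
  moreover have "f ` hall_heads m \<subseteq> hall_tails m - {(m - 2, m)}"
  proof
    fix x assume "x \<in> f ` hall_heads m"
    then obtain i j where x: "x = f (i, j)" and ij: "(i, j) \<in> hall_heads m"
      by auto
    show "x \<in> hall_tails m - {(m - 2, m)}"
    proof (cases "j = m - 1")
      case True
      then have i: "0 \<le> i" "i < m - 1" "odd (m - 1 - i)" "i mod 4 \<noteq> 1"
        using ij by (auto simp: hall_heads_def)
      then have i_mod: "i mod 4 = 3"
        using assms(2) by presburger
      have "(i - 2) mod 4 = 1"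
        using i_mod by presburger
      moreover have "0 \<le> i - 2"
        using i_mod i(1) by presburger
      moreover have "even (m - (i - 2))"
        using i(3) by presburger
      ultimately show ?thesis
        using True i x by (simp add: hall_tails_def f_def)
    next
      case False
      then show ?thesis
        using ij x by (auto simp: hall_tails_def hall_heads_def f_def)
    qed
  qed
  ultimately have "card (hall_heads m) \<le> card (hall_tails m - {(m - 2, m)})"
    using card_inj_on_le finite_hall_tails by blast
  also have "\<dots> < card (hall_tails m)"
  proof -
    have "(m - 2) mod 4 = 1" "0 \<le> m - 2"
      using assms by presburger+
    then have "(m - 2, m) \<in> hall_tails m"
      by (simp add: hall_tails_def)
    then show ?thesis
      using finite_hall_tails by (intro psubset_card_mono) auto
  qed
  finally show ?thesis .
qed

text \<open>
  A step that leaves \<open>L\<close> to the left, or past the diagonal, is caught by the parity of \<open>j - i\<close> and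
  by the ban on jumps. From a cell of \<open>L\<close>, every step to the right is clockwise, except possibly
  \<open>(2, 1)\<close>. That one is counter-clockwise only if the tail is less than twice as many rows above
  the pivot as it is columns to the left of it; as the tail also lies at least two rows above the
  diagonal, its column is at most \<open>m - 3\<close>, and the head stays clear of column \<open>m - 1\<close>.
\<close>

lemma hall_tails_arc:
  assumes n: "int n = 2 * m"
    and tail: "(i, j) \<in> hall_tails m" and arc: "((i, j), (i', j')) \<in> whirling_arcs n"
    and no_jump: "col_off n (i', j') > 0 \<or> row_off n (i', j') \<le> col_off n (i', j')"
  shows "(i', j') \<in> hall_heads m"
proof -
  have step: "knight_step (i, j) (i', j')" and "0 \<le> i'"
    and turn: "row_off n (i, j) * col_off n (i', j') > row_off n (i', j') * col_off n (i, j)"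
    using arc by (auto simp: whirling_arc_iff board_def)
  have no_jump': "j' \<ge> m \<or> i' \<le> j'"
    using no_jump n by (auto simp: row_off_def col_off_def)
  define a b where "a = i' - i" and "b = j' - j"
  have head: "i' = i + a" "j' = j + b"
    by (simp_all add: a_def b_def)
  have ab: "(a, b) \<in> {(1, 2), (1, -2), (-1, 2), (-1, -2), (2, 1), (2, -1), (-2, 1), (-2, -1)}"
    using knight_step_cases[OF step] by (simp add: a_def b_def)
  \<comment> \<open>the turning condition is linear in the tail once the step is known\<close>
  have "row_off n (i', j') = row_off n (i, j) + 2 * a" "col_off n (i', j') = col_off n (i, j) + 2 * b"
    by (simp_all add: row_off_def col_off_def head)
  then have "row_off n (i, j) * b > a * col_off n (i, j)"
    using turn by (simp add: ring_distribs)
  then have lin: "(2 * i - (2 * m - 1)) * b > a * (2 * j - (2 * m - 1))"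
    using n by (simp add: row_off_def col_off_def)
  have ij: "0 \<le> i" "i < j" "even (j - i)" "j < m \<or> j = m \<and> i mod 4 = 1"
    using tail by (auto simp: hall_tails_def)
  have bounds: "i \<le> j - 2" "j \<le> m"
    using ij by presburger+
  have steps: "(a, b) \<in> {(1, -2), (-1, -2), (2, -1), (-2, -1)} \<or> (a, b) = (2, 1) \<and> j + 2 < m"
    using ab lin bounds by (simp only: insert_iff empty_iff prod.inject) (elim disjE conjE; simp)
  have "odd (j' - i')"
    using ab ij(3) unfolding head by auto
  moreover have "j' < m"
    using steps bounds unfolding head by auto
  moreover have "i' < j'"
    using calculation no_jump' by (cases "i' = j'") auto
  moreover have "\<not> (j' = m - 1 \<and> i' mod 4 = 1)"
  proof
    assume "j' = m - 1 \<and> i' mod 4 = 1"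
    moreover from this have "j = m" "a = 2 \<or> a = -2"
      using steps bounds unfolding head by auto
    ultimately show False
      using ij(4) unfolding head by presburger
  qed
  ultimately have "i' < j' \<and> odd (j' - i') \<and> j' < m \<and> \<not> (j' = m - 1 \<and> i' mod 4 = 1)"
    by blast
  then show ?thesis
    using \<open>0 \<le> i'\<close> by (simp add: hall_heads_def)
qed

theorem theorem1:
  fixes n :: nat
  assumes "n \<ge> 6" and "n mod 8 = 6"
  shows "\<not> (\<exists>t. whirling_tour n t \<and> coil_count n t = n div 2)"
proof
  assume "\<exists>t. whirling_tour n t \<and> coil_count n t = n div 2"
  then obtain t where tour: "whirling_tour n t" and coils: "coil_count n t = n div 2"
    by blast
  define m where "m = int n div 2"
  have "even n"
    using assms by presburger
  have n: "int n = 2 * m" and m: "m mod 4 = 3" "0 \<le> m"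
    using assms unfolding m_def by presburger+
  note arcs = tour_bij(1)[OF tour] and tails = tour_bij(2)[OF tour] and heads = tour_bij(3)[OF tour]
  define successor where "successor = snd \<circ> inv_into (set t) fst"
  have bij: "bij_betw successor (board n) (board n)"
    unfolding successor_def by (rule bij_betw_trans[OF bij_betw_inv_into[OF tails] heads])
  have successor: "(c, successor c) \<in> set t" if "c \<in> board n" for c
  proof -
    have "inv_into (set t) fst c \<in> set t" "fst (inv_into (set t) fst c) = c"
      using that tails inv_into_into[of c fst "set t"] f_inv_into_f[of c fst "set t"]
      by (auto simp: bij_betw_def)
    then show ?thesis
      by (metis successor_def comp_apply prod.collapse)
  qed
  have board: "hall_tails m \<subseteq> board n"
    using n m by (auto simp: hall_tails_def board_def)
  have "successor ` hall_tails m \<subseteq> hall_heads m"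
  proof
    fix x assume "x \<in> successor ` hall_tails m"
    then obtain i j where x: "x = successor (i, j)" and ij: "(i, j) \<in> hall_tails m"
      by auto
    obtain i' j' where head: "successor (i, j) = (i', j')"
      by (cases "successor (i, j)")
    have arc: "((i, j), (i', j')) \<in> set t"
      using successor[of "(i, j)"] ij board head by auto
    have "row_off n (i, j) < col_off n (i, j)"
      using ij by (simp add: hall_tails_def row_off_def col_off_def)
    then have "col_off n (i', j') > 0 \<or> row_off n (i', j') \<le> col_off n (i', j')"
      using minimal_tour_no_diagonal_jump[OF \<open>even n\<close> tour coils arc] by simp
    then show "x \<in> hall_heads m"
      using hall_tails_arc[OF n ij] arc arcs x head by auto
  qed
  moreover have "inj_on successor (hall_tails m)"
    using bij board by (auto simp: bij_betw_def intro: inj_on_subset)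
  moreover have "finite (hall_heads m)"
    by (rule finite_subset[of _ "{0..m} \<times> {0..m}"]) (auto simp: hall_heads_def)
  ultimately have "card (hall_tails m) \<le> card (hall_heads m)"
    using card_inj_on_le by blast
  then show False
    using card_hall_heads_less[OF m(2) m(1)] by simp
qed

end
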